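(* Let $S$ be any preemptive, fixed-job-level-priority (FJP) global scheduling algorithm on $m$ DVFS-identical processors, and let $\tau$ be any set of sporadic constrained-deadline real-time tasks which is schedulable by $S$ when every job $\tau_{i,j}$ is executed at its offline speed $s_{i,j}^{\mathrm{off}}$ (i.e. all job deadlines are met under $S$ at these speeds, even if every job takes its worst-case execution time). Then every job deadline is still met when the system is scheduled by $S$ while using the algorithm MORA.
   Context: **Platform.** There are $m$ identical, independent processors $\mathcal P_1,\dots,\mathcal P_m$. Each has the same finite set of available speeds $0<s_1<\dots<s_K=s_{\max}=1$ and can change speed at any time, independently of the others, with no overhead. A job executing on a processor at speed $s$ for $R$ time units completes $s\cdot R$ execution units. Define $\widehat S(s)=\min\{s_k \mid s_k\ge s\}$. $P(s_k)$ is the power consumed at speed $s_k$ and $P_{\mathrm{idle}}$ the idle power. **Tasks.** $\tau=\{\tau_1,\dots,\tau_n\}$ is a set of independent sporadic constrained-deadline tasks $\tau_i=(C_i,D_i,T_i)$ with $D_i\le T_i$ and $C_i/D_i\le 1$. Task $\tau_i$ generates jobs $\tau_{i,j}$, $j=1,2,\dots$, at arrival times $a_{i,1}\ge 0$, $a_{i,j}\ge a_{i,j-1}+T_i$ (not known in advance). Each job requires at most $C_i$ execution units (its actual requirement may be smaller and is only known at its completion) and must complete by its absolute deadline $a_{i,j}+D_i$. A job is never executed on two processors simultaneously. Each task has an energy parameter $e_i$, and the energy of running $\tau_i$ for $R$ time units at speed $s_k$ is $E_i(R,s_k)=R\,(e_i(P(s_k)-P_{\mathrm{idle}})+P_{\mathrm{idle}})$.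 In a schedule, a job is *active* at time $t$ if it has arrived and is not completed; an active job is *running* if it is executing on a processor, and *waiting* otherwise. A job is *dispatched* at $t$ if it passes from waiting to running at $t$. **Scheduler.** $S$ is global, preemptive and FJP: each job receives on arrival a priority that stays constant until its completion; at each time the $m$ highest-priority active jobs (all of them if there are fewer than $m$) are running; a job may be preempted by a higher-priority job and may later resume on any processor; preemptions and migrations are free. **Offline schedule.** Each job has a fixed precomputed offline speed $s_{i,j}^{\mathrm{off}}$ (an available speed). The offline schedule is the schedule produced by $S$ (for the given arrival times) in which every job $\tau_{i,j}$ runs at speed $s_{i,j}^{\mathrm{off}}$ and requires exactly $C_i$ execution units. **Actual schedule and notation.** The actual schedule is the one produced when the system is scheduled by $S$ while using MORA (below), with actual execution requirements at most $C_i$. In it each active job has a current execution speed $s_{i,j}$ (the speed its processor adopts while executing it), set to $s_{i,j}^{\mathrm{off}}$ on arrival. $\mathrm{rem}_{i,j}(t)$ and $\mathrm{rem}^{\mathrm{off}}_{i,j}(t)$ denote the worst-case remaining execution time (at speed $s_{\max}=1$, relative to the WCET $C_i$) of $\tau_{i,j}$ at time $t$ in the actual and offline schedule respectively; each equals $C_i$ until the job starts executing in the corresponding schedule and $0$ once it is completed there. $\mathrm{disp}_{i,j}(t)$ is the earliest time at which $\tau_{i,j}$ is dispatched in the offline schedule when only the jobs active at $t$ in the offline schedule are considered. $\mathrm{nextdisp}(\mathcal P_\ell,t)$ is the earliest instant after $t$ at which a job not completed in the actual schedule at time $t$ is dispatched to $\mathcal P_\ell$ in the offline schedule, again considering only jobs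 active at $t$ in the offline schedule. (The algorithm obtains these quantities online.) **MORA.** The actual schedule is produced by the following rules. *Arrival.* When $\tau_{i,j}$ arrives, set $s_{i,j}\leftarrow s_{i,j}^{\mathrm{off}}$. *Rule 1.* Any job $\tau_{i,j}$ dispatched to a processor $\mathcal P_\ell$ at time $t$ in the offline schedule is also dispatched to $\mathcal P_\ell$ at time $t$ in the actual schedule (preempting any other job running on $\mathcal P_\ell$), and its speed is set to $s_{i,j}\leftarrow \widehat S\big(\mathrm{rem}_{i,j}(t)\,s_{i,j}^{\mathrm{off}}/\mathrm{rem}^{\mathrm{off}}_{i,j}(t)\big)$. *Rule 2.* Whenever a processor $\mathcal P_r$ is about to get idle at time $t$ in the actual schedule: for every job $\tau_{i,j}$ waiting at $t$ in the actual schedule compute $L_{i,j}(t)=\min(\mathrm{nextdisp}(\mathcal P_r,t),\mathrm{disp}_{i,j}(t))-t$, $s'_{i,j}=\widehat S\Big(\frac{\mathrm{rem}_{i,j}(t)\,s_{i,j}^{\mathrm{off}}}{\mathrm{rem}^{\mathrm{off}}_{i,j}(t)+L_{i,j}(t)\,s_{i,j}^{\mathrm{off}}}\Big)$, $s''_{i,j}=\widehat S\Big(\frac{\mathrm{rem}_{i,j}(t)\,s_{i,j}^{\mathrm{off}}}{\mathrm{rem}^{\mathrm{off}}_{i,j}(t)}\Big)$, $\Delta E_{i,j}=E_i\big(\mathrm{rem}_{i,j}(t)/s''_{i,j},s''_{i,j}\big)-E_i\big(\mathrm{rem}_{i,j}(t)/s'_{i,j},s'_{i,j}\big)$. Dispatch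 to $\mathcal P_r$ the waiting job $\tau_{k,\ell}$ with largest $\Delta E_{k,\ell}$; if $\Delta E_{i,j}\le 0$ for all waiting jobs, dispatch instead the highest-priority waiting job (if any). If a job $\tau_{k,\ell}$ was selected, set $s_{k,\ell}\leftarrow s'_{k,\ell}$; otherwise $\mathcal P_r$ becomes idle. If a processor is about to get idle in the actual schedule exactly when a job is dispatched in the offline one, only Rule 1 is applied. *)

theory Defs
  imports "HOL-Analysis.Analysis"
begin

text \<open>The job \<open>(i, j)\<close> is the \<open>j\<close>-th job of task \<open>i\<close>; tasks, jobs of a task and processors
  are numbered from 1.\<close>

type_synonym job = "nat \<times> nat"

record system =
  num_procs :: nat
  speeds :: "real set"
  power_at :: "real \<Rightarrow> real"
  idle_power :: real
  num_tasks :: nat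
  wcet :: "nat \<Rightarrow> real"
  rel_deadline :: "nat \<Rightarrow> real"
  period :: "nat \<Rightarrow> real"
  energy_param :: "nat \<Rightarrow> real"
  off_speed :: "job \<Rightarrow> real"

definition procs :: "system \<Rightarrow> nat set" where
  "procs Sys = {1..num_procs Sys}"

definition valid_system :: "system \<Rightarrow> bool" where
  "valid_system Sys \<longleftrightarrow>
     1 \<le> num_procs Sys \<and>
     finite (speeds Sys) \<and> speeds Sys \<noteq> {} \<and> (\<forall>s\<in>speeds Sys. 0 < s) \<and> Max (speeds Sys) = 1 \<and>
     (\<forall>i\<in>{1..num_tasks Sys}.
        0 < wcet Sys i \<and> 0 < rel_deadline Sys i \<and>
        wcet Sys i / rel_deadline Sys i \<le> 1 \<and> rel_deadline Sys i \<le> period Sys i) \<and>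
     (\<forall>i\<in>{1..num_tasks Sys}. \<forall>j\<ge>1. off_speed Sys (i, j) \<in> speeds Sys)"

text \<open>Only meaningful if \<open>x\<close> does not exceed the largest available speed.\<close>

definition speed_ceil :: "system \<Rightarrow> real \<Rightarrow> real" where
  "speed_ceil Sys x = Min {s \<in> speeds Sys. x \<le> s}"

definition energy :: "system \<Rightarrow> nat \<Rightarrow> real \<Rightarrow> real \<Rightarrow> real" where
  "energy Sys i R s =
     R * (energy_param Sys i * (power_at Sys s - idle_power Sys) + idle_power Sys)"

text \<open>An arrival pattern gives the arrival time of every job that is ever generated; a task may
  generate finitely or infinitely many jobs.\<close>

type_synonym arrivals = "job \<rightharpoonup> real"

definition sporadic :: "system \<Rightarrow> arrivals \<Rightarrow> bool" where
  "sporadic Sys arr \<longleftrightarrow>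
     dom arr \<subseteq> {1..num_tasks Sys} \<times> {1..} \<and>
     (\<forall>i j a. arr (i, j) = Some a \<longrightarrow>
        0 \<le> a \<and> (2 \<le> j \<longrightarrow> (\<exists>b. arr (i, j - 1) = Some b \<and> b + period Sys i \<le> a)))"

definition arrivals_until :: "real \<Rightarrow> arrivals \<Rightarrow> arrivals" where
  "arrivals_until t arr = arr |` {j. \<exists>a. arr j = Some a \<and> a \<le> t}"

text \<open>A run records which job each processor executes at each time (\<open>None\<close>: the processor is
  idle), the current speed of each job, and the number of execution units each job really
  requires.\<close>

record run =
  arrival :: arrivals
  place :: "nat \<Rightarrow> real \<Rightarrow> job option"
  speed :: "job \<Rightarrow> real \<Rightarrow> real"
  demand :: "job \<Rightarrow> real"

text \<open>Functions of time are right-continuous step functions, with finitely many steps in every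
  bounded interval; hence \<open>f t\<close> is the value from \<open>t\<close> on, and \<open>just_before f t\<close> the value that
  is in force immediately before \<open>t\<close>.\<close>

definition step_function :: "(real \<Rightarrow> 'a) \<Rightarrow> bool" where
  "step_function f \<longleftrightarrow>
     (\<forall>t. (\<forall>\<^sub>F u in at_right t. f u = f t) \<and> (\<exists>x. \<forall>\<^sub>F u in at_left t. f u = x))"

definition just_before :: "(real \<Rightarrow> 'a) \<Rightarrow> real \<Rightarrow> 'a" where
  "just_before f t = (THE x. \<forall>\<^sub>F u in at_left t. f u = x)"

definition running :: "system \<Rightarrow> run \<Rightarrow> job \<Rightarrow> real \<Rightarrow> bool" where
  "running Sys R j t \<longleftrightarrow> (\<exists>p\<in>procs Sys. place R p t = Some j)"

definition executed :: "system \<Rightarrow> run \<Rightarrow> job \<Rightarrow> real \<Rightarrow> real" where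
  "executed Sys R j t = integral {0..t} (\<lambda>u. if running Sys R j u then speed R j u else 0)"

definition arrived :: "run \<Rightarrow> job \<Rightarrow> real \<Rightarrow> bool" where
  "arrived R j t \<longleftrightarrow> (\<exists>a. arrival R j = Some a \<and> a \<le> t)"

definition completed :: "system \<Rightarrow> run \<Rightarrow> job \<Rightarrow> real \<Rightarrow> bool" where
  "completed Sys R j t \<longleftrightarrow> arrived R j t \<and> demand R j \<le> executed Sys R j t"

definition active :: "system \<Rightarrow> run \<Rightarrow> job \<Rightarrow> real \<Rightarrow> bool" where
  "active Sys R j t \<longleftrightarrow> arrived R j t \<and> \<not> completed Sys R j t"

text \<open>The worst-case remaining execution time refers to the WCET, not to the (unknown) demand.\<close>

definition remaining :: "system \<Rightarrow> run \<Rightarrow> job \<Rightarrow> real \<Rightarrow> real" where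
  "remaining Sys R j t =
     (if completed Sys R j t then 0 else wcet Sys (fst j) - executed Sys R j t)"

text \<open>A job that starts executing at its very arrival is dispatched at that time.\<close>

definition dispatched :: "system \<Rightarrow> run \<Rightarrow> job \<Rightarrow> nat \<Rightarrow> real \<Rightarrow> bool" where
  "dispatched Sys R j p t \<longleftrightarrow>
     place R p t = Some j \<and> (\<forall>q\<in>procs Sys. just_before (place R q) t \<noteq> Some j)"

definition deadlines_met :: "system \<Rightarrow> run \<Rightarrow> bool" where
  "deadlines_met Sys R \<longleftrightarrow>
     (\<forall>j a. arrival R j = Some a \<longrightarrow> completed Sys R j (a + rel_deadline Sys (fst j)))"

text \<open>Arrival times being nonnegative, every processor is idle at negative times.\<close>

definition legal_run :: "system \<Rightarrow> run \<Rightarrow> bool" where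
  "legal_run Sys R \<longleftrightarrow>
     (\<forall>p\<in>procs Sys. step_function (place R p)) \<and>
     (\<forall>j. step_function (speed R j)) \<and>
     (\<forall>p\<in>procs Sys. \<forall>j t. place R p t = Some j \<longrightarrow> active Sys R j t) \<and>
     (\<forall>p\<in>procs Sys. \<forall>q\<in>procs Sys. \<forall>j t.
        place R p t = Some j \<and> place R q t = Some j \<longrightarrow> p = q)"

text \<open>A scheduler assigns priorities (greater values are higher priorities) and, for every arrival
  pattern, determines the processor assignment that results when all jobs run at their offline
  speeds and require their WCET.\<close>

record 'p scheduler =
  prio :: "arrivals \<Rightarrow> job \<Rightarrow> 'p"
  offline_place :: "arrivals \<Rightarrow> nat \<Rightarrow> real \<Rightarrow> job option"

definition offline_run :: "system \<Rightarrow> 'p scheduler \<Rightarrow> arrivals \<Rightarrow> run" where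
  "offline_run Sys S arr =
     \<lparr>arrival = arr, place = offline_place S arr,
      speed = (\<lambda>j t. off_speed Sys j), demand = (\<lambda>j. wcet Sys (fst j))\<rparr>"

definition runs_highest_priorities ::
  "system \<Rightarrow> (job \<Rightarrow> 'p::linorder) \<Rightarrow> run \<Rightarrow> bool" where
  "runs_highest_priorities Sys pr R \<longleftrightarrow>
     (\<forall>j t. running Sys R j t \<longleftrightarrow>
        active Sys R j t \<and> card {k. active Sys R k t \<and> pr j < pr k} < num_procs Sys)"

text \<open>A job changes processor only by being preempted and resuming later.\<close>

definition migrates_only_on_resumption :: "system \<Rightarrow> run \<Rightarrow> bool" where
  "migrates_only_on_resumption Sys R \<longleftrightarrow>
     (\<forall>p\<in>procs Sys. \<forall>j t.
        just_before (place R p) t = Some j \<and> running Sys R j t \<longrightarrow> place R p t = Some j)"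

text \<open>The last conjunct states that the scheduler works online: the priorities of the jobs arrived
  by time \<open>t\<close> and the processor assignment up to \<open>t\<close> do not depend on later arrivals.\<close>

definition fjp_scheduler :: "system \<Rightarrow> 'p::linorder scheduler \<Rightarrow> bool" where
  "fjp_scheduler Sys S \<longleftrightarrow>
     (\<forall>arr. sporadic Sys arr \<longrightarrow>
        inj_on (prio S arr) (dom arr) \<and>
        legal_run Sys (offline_run Sys S arr) \<and>
        runs_highest_priorities Sys (prio S arr) (offline_run Sys S arr) \<and>
        migrates_only_on_resumption Sys (offline_run Sys S arr)) \<and>
     (\<forall>arr arr' t. sporadic Sys arr \<and> sporadic Sys arr' \<and> arrivals_until t arr = arrivals_until t arr' \<longrightarrow>
        (\<forall>j\<in>dom (arrivals_until t arr). prio S arr j = prio S arr' j) \<and>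
        (\<forall>p\<in>procs Sys. \<forall>u\<le>t. offline_place S arr p u = offline_place S arr' p u))"

definition schedulable_offline :: "system \<Rightarrow> 'p scheduler \<Rightarrow> bool" where
  "schedulable_offline Sys S \<longleftrightarrow>
     (\<forall>arr. sporadic Sys arr \<longrightarrow> deadlines_met Sys (offline_run Sys S arr))"

text \<open>The offline schedule when only the jobs active in it at time \<open>t\<close> are considered from \<open>t\<close> on:
  by online-ness it agrees with the offline schedule up to \<open>t\<close>, and every job that arrived by
  \<open>t\<close> and is not active at \<open>t\<close> has been completed.\<close>

definition forecast :: "system \<Rightarrow> 'p scheduler \<Rightarrow> arrivals \<Rightarrow> real \<Rightarrow> run" where
  "forecast Sys S arr t = offline_run Sys S (arrivals_until t arr)"

definition disp :: "system \<Rightarrow> 'p scheduler \<Rightarrow> arrivals \<Rightarrow> job \<Rightarrow> real \<Rightarrow> ereal" where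
  "disp Sys S arr j t =
     Inf (ereal ` {u. t \<le> u \<and> (\<exists>p\<in>procs Sys. dispatched Sys (forecast Sys S arr t) j p u)})"

text \<open>This is infinite if there is no such dispatch.\<close>

definition nextdisp :: "system \<Rightarrow> 'p scheduler \<Rightarrow> run \<Rightarrow> nat \<Rightarrow> real \<Rightarrow> ereal" where
  "nextdisp Sys S R p t =
     Inf (ereal ` {u. t < u \<and> (\<exists>j. \<not> completed Sys R j t \<and>
                                   dispatched Sys (forecast Sys S (arrival R) t) j p u)})"

text \<open>The minimum is finite for every job that is active and not running in the offline schedule
  at \<open>t\<close>, since such a job is eventually dispatched once no further jobs arrive.\<close>

definition slack_length :: "system \<Rightarrow> 'p scheduler \<Rightarrow> run \<Rightarrow> nat \<Rightarrow> job \<Rightarrow> real \<Rightarrow> real" where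
  "slack_length Sys S R r j t =
     real_of_ereal (min (nextdisp Sys S R r t) (disp Sys S (arrival R) j t) - ereal t)"

definition slow_speed :: "system \<Rightarrow> 'p scheduler \<Rightarrow> run \<Rightarrow> nat \<Rightarrow> job \<Rightarrow> real \<Rightarrow> real" where
  "slow_speed Sys S R r j t =
     speed_ceil Sys
       (remaining Sys R j t * off_speed Sys j /
        (remaining Sys (offline_run Sys S (arrival R)) j t
           + slack_length Sys S R r j t * off_speed Sys j))"

definition catch_up_speed :: "system \<Rightarrow> 'p scheduler \<Rightarrow> run \<Rightarrow> job \<Rightarrow> real \<Rightarrow> real" where
  "catch_up_speed Sys S R j t =
     speed_ceil Sys
       (remaining Sys R j t * off_speed Sys j /
        remaining Sys (offline_run Sys S (arrival R)) j t)"

definition energy_saving :: "system \<Rightarrow> 'p scheduler \<Rightarrow> run \<Rightarrow> nat \<Rightarrow> job \<Rightarrow> real \<Rightarrow> real" where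
  "energy_saving Sys S R r j t =
     (let w = remaining Sys R j t;
          s1 = slow_speed Sys S R r j t;
          s2 = catch_up_speed Sys S R j t
      in energy Sys (fst j) (w / s2) s2 - energy Sys (fst j) (w / s1) s1)"

text \<open>The events of one instant \<open>t\<close> are processed in the order completions and arrivals, Rule 1,
  Rule 2. Intermediate states within the instant consist of a processor assignment and the
  current speeds.\<close>

type_synonym state = "(nat \<Rightarrow> job option) \<times> (job \<Rightarrow> real)"

definition after_completions :: "system \<Rightarrow> run \<Rightarrow> real \<Rightarrow> nat \<Rightarrow> job option" where
  "after_completions Sys R t p =
     (case just_before (place R p) t of
        None \<Rightarrow> None
      | Some j \<Rightarrow> if active Sys R j t then Some j else None)"

definition after_arrivals :: "system \<Rightarrow> run \<Rightarrow> real \<Rightarrow> job \<Rightarrow> real" where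
  "after_arrivals Sys R t j =
     (if arrival R j = Some t then off_speed Sys j else just_before (speed R j) t)"

text \<open>Rule 1 concerns the jobs that are still active in the actual schedule. A job that already
  executes on another processor is moved.\<close>

definition rule1 :: "system \<Rightarrow> 'p scheduler \<Rightarrow> run \<Rightarrow> real \<Rightarrow> state" where
  "rule1 Sys S R t =
     (let Off = offline_run Sys S (arrival R) in
      ((\<lambda>p. if \<exists>j. active Sys R j t \<and> dispatched Sys Off j p t then place Off p t
            else case after_completions Sys R t p of
                   None \<Rightarrow> None
                 | Some j \<Rightarrow> if \<exists>q\<in>procs Sys. dispatched Sys Off j q t then None else Some j),
       (\<lambda>j. if active Sys R j t \<and> (\<exists>p\<in>procs Sys. dispatched Sys Off j p t)
            then catch_up_speed Sys S R j t
            else after_arrivals Sys R t j)))"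

definition waiting_in :: "system \<Rightarrow> run \<Rightarrow> real \<Rightarrow> state \<Rightarrow> job set" where
  "waiting_in Sys R t st = {j. active Sys R j t \<and> (\<forall>p\<in>procs Sys. fst st p \<noteq> Some j)}"

definition rule2_selects ::
  "system \<Rightarrow> 'p::linorder scheduler \<Rightarrow> run \<Rightarrow> real \<Rightarrow> nat \<Rightarrow> job set \<Rightarrow> job \<Rightarrow> bool" where
  "rule2_selects Sys S R t r W j \<longleftrightarrow>
     j \<in> W \<and>
     (if \<forall>k\<in>W. energy_saving Sys S R r k t \<le> 0
      then \<forall>k\<in>W. prio S (arrival R) k \<le> prio S (arrival R) j
      else \<forall>k\<in>W. energy_saving Sys S R r k t \<le> energy_saving Sys S R r j t)"

definition rule2 ::
  "system \<Rightarrow> 'p::linorder scheduler \<Rightarrow> run \<Rightarrow> real \<Rightarrow> nat \<Rightarrow> state \<Rightarrow> state \<Rightarrow> bool" where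
  "rule2 Sys S R t r st st' \<longleftrightarrow>
     (let W = waiting_in Sys R t st in
      if W = {} then st' = st
      else \<exists>j. rule2_selects Sys S R t r W j \<and>
               st' = ((fst st)(r := Some j), (snd st)(j := slow_speed Sys S R r j t)))"

fun rule2_all ::
  "system \<Rightarrow> 'p::linorder scheduler \<Rightarrow> run \<Rightarrow> real \<Rightarrow> nat list \<Rightarrow> state \<Rightarrow> state \<Rightarrow> bool" where
  "rule2_all Sys S R t [] st st' \<longleftrightarrow> st' = st"
| "rule2_all Sys S R t (r # rs) st st' \<longleftrightarrow>
     (\<exists>st1. rule2 Sys S R t r st st1 \<and> rule2_all Sys S R t rs st1 st')"

text \<open>Rule 2 is not triggered at an instant at which the offline schedule dispatches some job. Ties
  are resolved arbitrarily: several processors that get idle at the same instant are treated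
  one after the other, in any order.\<close>

definition rule2_procs :: "system \<Rightarrow> 'p scheduler \<Rightarrow> run \<Rightarrow> real \<Rightarrow> nat set" where
  "rule2_procs Sys S R t =
     (if \<exists>j. \<exists>p\<in>procs Sys. dispatched Sys (offline_run Sys S (arrival R)) j p t then {}
      else {r \<in> procs Sys. just_before (place R r) t \<noteq> None \<and> fst (rule1 Sys S R t) r = None})"

definition mora_run :: "system \<Rightarrow> 'p::linorder scheduler \<Rightarrow> run \<Rightarrow> bool" where
  "mora_run Sys S R \<longleftrightarrow>
     legal_run Sys R \<and>
     (\<forall>t. \<exists>rs st. distinct rs \<and> set rs = rule2_procs Sys S R t \<and>
            rule2_all Sys S R t rs (rule1 Sys S R t) st \<and>
            (\<forall>p\<in>procs Sys. place R p t = fst st p) \<and>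
            (\<forall>j. speed R j t = snd st j))"

end

(*
  Fix a job; let x and y be the work done on it by time t in the actual and in the offline
  schedule, c its WCET, s its current and soff its offline speed. As long as the job is not
  completed in the actual schedule, y <= x, and whenever it runs offline it also runs on the same
  processor in the actual schedule, with (c - x) * soff <= s * (c - y). Rule 1 establishes the last
  inequality when the job is dispatched offline, and running at constant speeds preserves it
  and y <= x. Rule 2 only touches jobs waiting in the actual schedule, hence waiting offline,
  and Rule 1 resets their speeds before they next run offline; so of the slack length only its
  nonnegativity matters, which makes the slow speed an available one. Once y = c, the job is
  completed in the actual schedule.
*)
theory Submission
  imports Defs
begin

section \<open>Step functions\<close>

text \<open>Induction along a half-line: at the infimum of the counterexamples, \<open>left\<close>
  gives \<open>Q\<close>, and \<open>right\<close> then extends \<open>Q\<close> beyond it. The base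
  case \<open>t = a\<close> is the instance of \<open>left\<close> whose premise is vacuous. This
  form suits step functions, which are known just before and just after every instant.\<close>

lemma real_right_induct [consumes 1, case_names left right]:
  fixes a t :: real
  assumes "a \<le> t"
    and left: "\<And>t. a \<le> t \<Longrightarrow> (\<And>u. a \<le> u \<Longrightarrow> u < t \<Longrightarrow> Q u) \<Longrightarrow> Q t"
    and right: "\<And>t. a \<le> t \<Longrightarrow> (\<And>u. a \<le> u \<Longrightarrow> u \<le> t \<Longrightarrow> Q u) \<Longrightarrow> \<forall>\<^sub>F u in at_right t. Q u"
  shows "Q t"
proof (rule ccontr)
  assume "\<not> Q t"
  define B where "B = {t. a \<le> t \<and> \<not> Q t}"
  define m where "m = Inf B"
  have ne: "t \<in> B" using \<open>\<not> Q t\<close> assms(1) by (simp add: B_def)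
  have bdd: "bdd_below B" by (auto simp: B_def bdd_below_def)
  have "a \<le> m" unfolding m_def using ne by (intro cInf_greatest) (auto simp: B_def)
  have below: "Q u" if "a \<le> u" "u < m" for u
    using that cInf_lower[OF _ bdd, of u] by (force simp: m_def B_def)
  have "Q m" using left[OF \<open>a \<le> m\<close>] below by blast
  with below have "\<forall>\<^sub>F u in at_right m. Q u"
    by (intro right[OF \<open>a \<le> m\<close>]) (metis order_le_less)
  then obtain b where b: "m < b" "\<And>u. m < u \<Longrightarrow> u < b \<Longrightarrow> Q u"
    by (auto simp: eventually_at_right_field)
  \<comment> \<open>No counterexample lies below \<open>m\<close>, at \<open>m\<close>, or strictly
    between \<open>m\<close> and \<open>b\<close>.\<close>
  have "b \<le> Inf B"
  proof (rule cInf_greatest)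
    show "B \<noteq> {}" using ne by auto
    fix x assume x: "x \<in> B"
    then have "m \<le> x" using bdd by (auto simp: m_def intro: cInf_lower)
    then show "b \<le> x" using x b(2)[of x] \<open>Q m\<close> by (cases "x = m") (auto simp: B_def not_le[symmetric])
  qed
  with b(1) show False by (simp add: m_def)
qed

lemma just_before_eq:
  fixes f :: "real \<Rightarrow> 'a"
  assumes "\<forall>\<^sub>F u in at_left t. f u = x"
  shows "just_before f t = x"
  unfolding just_before_def
proof (rule the_equality)
  show "\<forall>\<^sub>F u in at_left t. f u = x" by (fact assms)
next
  fix y assume "\<forall>\<^sub>F u in at_left t. f u = y"
  with assms have "\<forall>\<^sub>F u in at_left t. y = x" by eventually_elim simp
  then show "y = x" by simp
qed

lemma step_function_at_left:
  assumes "step_function f"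
  shows "\<forall>\<^sub>F u in at_left t. f u = just_before f t"
proof -
  obtain x where x: "\<forall>\<^sub>F u in at_left t. f u = x" using assms by (auto simp: step_function_def)
  with just_before_eq[OF x] show ?thesis by simp
qed

lemma step_function_at_right:
  "step_function f \<Longrightarrow> \<forall>\<^sub>F u in at_right t. f u = f t"
  by (auto simp: step_function_def)

text \<open>The endpoints are left free: between two steps only the interior values of a step
  function are known.\<close>

lemma integral_const_interior:
  fixes f :: "real \<Rightarrow> real"
  assumes "u \<le> v" "\<And>w. u < w \<Longrightarrow> w < v \<Longrightarrow> f w = k"
  shows "(f has_integral (k * (v - u))) {u..v}"
proof (rule has_integral_spike_finite[of "{u, v}"])
  show "((\<lambda>_. k) has_integral (k * (v - u))) {u..v}"
    using has_integral_const_real[of k u v] assms(1) by (simp add: mult.commute)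
qed (use assms(2) in auto)

lemma step_function_integrable:
  fixes f :: "real \<Rightarrow> real"
  assumes "step_function f" "a \<le> t"
  shows "f integrable_on {a..t}"
  using assms(2)
proof (induction t rule: real_right_induct)
  case (left t)
  show ?case
  proof (cases "t = a")
    case False
    with left have "a < t" by simp
    obtain b where b: "b < t" "\<And>u. b < u \<Longrightarrow> u < t \<Longrightarrow> f u = just_before f t"
      using step_function_at_left[OF assms(1), of t] by (auto simp: eventually_at_left_field)
    \<comment> \<open>The maximum keeps the constant stretch inside \<open>{a..t}\<close>.\<close>
    define w where "w = max a b"
    have w: "a \<le> w" "w < t" using \<open>a < t\<close> b(1) by (auto simp: w_def)
    have "f integrable_on {w..t}"
      using integral_const_interior[of w t f "just_before f t"] b(2) w
      by (auto simp: w_def integrable_on_def)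
    with left(2)[OF w] w show ?thesis
      by (meson Henstock_Kurzweil_Integration.integrable_combine less_imp_le)
  qed (use integrable_on_refl[of f a] in simp)
next
  case (right t)
  obtain b where b: "t < b" "\<And>u. t < u \<Longrightarrow> u < b \<Longrightarrow> f u = f t"
    using step_function_at_right[OF assms(1), of t] by (auto simp: eventually_at_right_field)
  have "f integrable_on {a..u}" if "t < u" "u < b" for u
  proof -
    have "f integrable_on {t..u}"
      using integral_const_interior[of t u f "f t"] b(2) that by (auto simp: integrable_on_def)
    with right that show ?thesis
      by (meson Henstock_Kurzweil_Integration.integrable_combine less_imp_le order_refl)
  qed
  with b(1) show ?case by (auto simp: eventually_at_right_field)
qed

section \<open>Execution in legal runs\<close>

text \<open>The integrand of \<open>executed\<close>, named so that it can be treated as a step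
  function.\<close>

definition exec_rate :: "system \<Rightarrow> run \<Rightarrow> job \<Rightarrow> real \<Rightarrow> real" where
  "exec_rate Sys R j u = (if running Sys R j u then speed R j u else 0)"

lemma executed_exec_rate: "executed Sys R j t = integral {0..t} (exec_rate Sys R j)"
  by (simp add: executed_def exec_rate_def[abs_def])

lemma finite_procs [simp]: "finite (procs Sys)"
  by (simp add: procs_def)

lemma legal_step:
  assumes "legal_run Sys R"
  shows "p \<in> procs Sys \<Longrightarrow> step_function (place R p)" "step_function (speed R j)"
  using assms unfolding legal_run_def by (simp_all del: split_paired_All)

lemma legal_active:
  "legal_run Sys R \<Longrightarrow> p \<in> procs Sys \<Longrightarrow> place R p t = Some j \<Longrightarrow> active Sys R j t"
  unfolding legal_run_def by blast

text \<open>As there are finitely many processors, all placements are constant together on one short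
  interval on either side of \<open>t\<close>.\<close>

lemma step_exec_rate:
  assumes "legal_run Sys R"
  shows "step_function (exec_rate Sys R j)"
  unfolding step_function_def
proof (intro allI conjI)
  fix t
  have "\<forall>\<^sub>F u in at_right t. \<forall>p\<in>procs Sys. place R p u = place R p t"
    using step_function_at_right[OF legal_step(1)[OF assms]] by (simp add: eventually_ball_finite)
  with step_function_at_right[OF legal_step(2)[OF assms], of j t]
  show "\<forall>\<^sub>F u in at_right t. exec_rate Sys R j u = exec_rate Sys R j t"
    by eventually_elim (simp add: exec_rate_def running_def)
  have "\<forall>\<^sub>F u in at_left t. \<forall>p\<in>procs Sys. place R p u = just_before (place R p) t"
    using step_function_at_left[OF legal_step(1)[OF assms]] by (simp add: eventually_ball_finite)
  with step_function_at_left[OF legal_step(2)[OF assms], of j t]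
  have "\<forall>\<^sub>F u in at_left t. exec_rate Sys R j u =
     (if \<exists>p\<in>procs Sys. just_before (place R p) t = Some j then just_before (speed R j) t else 0)"
    by eventually_elim (simp add: exec_rate_def running_def)
  then show "\<exists>x. \<forall>\<^sub>F u in at_left t. exec_rate Sys R j u = x" by blast
qed

lemma continuous_executed:
  assumes "legal_run Sys R"
  shows "continuous_on {0..b} (executed Sys R j)"
proof (cases "0 \<le> b")
  case True
  from indefinite_integral_continuous_1[OF step_function_integrable[OF step_exec_rate[OF assms] this]]
  show ?thesis by (simp add: executed_exec_rate[abs_def])
qed auto

lemma executed_diff:
  assumes "legal_run Sys R" "0 \<le> u" "u \<le> v"
  shows "executed Sys R j v = executed Sys R j u + integral {u..v} (exec_rate Sys R j)"
  using Henstock_Kurzweil_Integration.integral_combine[OF assms(2,3), of "exec_rate Sys R j"]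
    step_function_integrable[OF step_exec_rate[OF assms(1)], of 0 v] assms
  by (simp add: executed_exec_rate)

lemma executed_const_rate:
  assumes "legal_run Sys R" "0 \<le> u" "u \<le> v" "\<And>w. u < w \<Longrightarrow> w < v \<Longrightarrow> exec_rate Sys R j w = k"
  shows "executed Sys R j v = executed Sys R j u + k * (v - u)"
  using executed_diff[OF assms(1-3)] integral_unique[OF integral_const_interior[OF assms(3,4)]] by simp

text \<open>Nonnegative speeds are assumed only strictly between \<open>u\<close> and
  \<open>v\<close>, because the lemma is applied while the invariant is still to be proved at
  \<open>v\<close>.\<close>

lemma executed_mono:
  assumes "legal_run Sys R" "0 \<le> u" "u \<le> v" "\<And>w. u < w \<Longrightarrow> w < v \<Longrightarrow> 0 \<le> speed R j w"
  shows "executed Sys R j u \<le> executed Sys R j v"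
proof -
  \<comment> \<open>Zeroing the endpoints makes the integrand nonnegative everywhere without
    changing its integral.\<close>
  define f where "f w = (if w \<in> {u, v} then 0 else exec_rate Sys R j w)" for w
  have "f integrable_on {u..v}"
    by (rule integrable_spike_finite[of "{u, v}", OF _ _ step_function_integrable[OF step_exec_rate[OF assms(1)] assms(3)]])
      (auto simp: f_def)
  then have "0 \<le> integral {u..v} f"
    by (rule Henstock_Kurzweil_Integration.integral_nonneg) (use assms(4) in \<open>auto simp: f_def exec_rate_def\<close>)
  also have "integral {u..v} f = integral {u..v} (exec_rate Sys R j)"
    by (rule integral_spike[of "{u, v}"]) (auto simp: f_def)
  finally have "0 \<le> integral {u..v} (exec_rate Sys R j)" .
  then show ?thesis using executed_diff[OF assms(1-3)] by simp
qed

lemma executed_at_arrival: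
  assumes "legal_run Sys R" "arrival R j = Some a" "0 \<le> a"
  shows "executed Sys R j a = 0"
proof -
  have "exec_rate Sys R j w = 0" if "w < a" for w
  proof -
    have "\<not> active Sys R j w" using assms(2) that by (simp add: active_def arrived_def)
    then show ?thesis
      using legal_active[OF assms(1), of _ w j] by (auto simp: exec_rate_def running_def simp del: split_paired_All split_paired_Ex)
  qed
  then have "executed Sys R j a = executed Sys R j 0 + 0 * (a - 0)"
    using assms by (intro executed_const_rate) auto
  then show ?thesis by (simp add: executed_def)
qed

text \<open>Carries non-strict inequalities about executed work from just before \<open>t\<close> to
  \<open>t\<close>.\<close>

lemma executed_tendsto_left:
  assumes "legal_run Sys R" "0 < t"
  shows "(executed Sys R j \<longlongrightarrow> executed Sys R j t) (at_left t)"
  using continuous_on_Icc_at_leftD[OF continuous_executed[OF assms(1)] assms(2)] .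

section \<open>Speeds and slack\<close>

lemma valid_speeds:
  assumes "valid_system Sys"
  shows "finite (speeds Sys)" "1 \<in> speeds Sys" "s \<in> speeds Sys \<Longrightarrow> 0 < s" "s \<in> speeds Sys \<Longrightarrow> s \<le> 1"
  using assms Max_in[of "speeds Sys"] Max_ge[of "speeds Sys" s] by (auto simp: valid_system_def)

lemma speed_ceil:
  assumes "valid_system Sys" "r \<le> 1"
  shows "speed_ceil Sys r \<in> speeds Sys" "r \<le> speed_ceil Sys r"
proof -
  have "finite {s \<in> speeds Sys. r \<le> s}" "{s \<in> speeds Sys. r \<le> s} \<noteq> {}"
    using valid_speeds(1,2)[OF assms(1)] assms(2) by auto
  from Min_in[OF this] show "speed_ceil Sys r \<in> speeds Sys" "r \<le> speed_ceil Sys r"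
    by (simp_all add: speed_ceil_def)
qed

lemma slack_length_nonneg: "0 \<le> slack_length Sys S R r j t"
proof -
  have "ereal t \<le> nextdisp Sys S R r t" "ereal t \<le> disp Sys S (arrival R) j t"
    unfolding nextdisp_def disp_def by (auto intro!: INF_greatest)
  then show ?thesis
    \<comment> \<open>If both infima are infinite, \<open>real_of_ereal\<close> yields 0, so the
      bound holds then too.\<close>
    unfolding slack_length_def by (intro real_of_ereal_pos ereal_diff_positive) simp
qed

section \<open>Rule 2\<close>

text \<open>A job placed on \<open>p\<close> is not waiting, so no selection picks it and changes
  its speed; it stays on \<open>p\<close> because no processor in \<open>rs\<close> is
  \<open>p\<close>.\<close>

lemma rule2_all_keeps:
  assumes "rule2_all Sys S R t rs st st'" "p \<in> procs Sys" "p \<notin> set rs" "fst st p = Some j"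
  shows "fst st' p = Some j \<and> snd st' j = snd st j"
  using assms
proof (induction rs arbitrary: st)
  case (Cons r rs)
  then obtain st1 where st1: "rule2 Sys S R t r st st1" "rule2_all Sys S R t rs st1 st'"
    by auto
  have "fst st1 p = Some j \<and> snd st1 j = snd st j"
    using st1(1) Cons.prems
    by (auto simp: rule2_def rule2_selects_def waiting_in_def Let_def split: if_splits)
  with Cons.IH[OF st1(2)] Cons.prems show ?case by auto
qed simp

text \<open>Only waiting, hence active, jobs get a new speed, and the last assignment
  counts.\<close>

lemma rule2_all_speed:
  assumes "rule2_all Sys S R t rs st st'"
  shows "snd st' j = snd st j \<or> active Sys R j t \<and> (\<exists>r. snd st' j = slow_speed Sys S R r j t)"
  using assms
proof (induction rs arbitrary: st)
  case (Cons r rs)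
  then obtain st1 where st1: "rule2 Sys S R t r st st1" "rule2_all Sys S R t rs st1 st'"
    by auto
  have "snd st1 j = snd st j \<or> active Sys R j t \<and> snd st1 j = slow_speed Sys S R r j t"
  proof (cases "waiting_in Sys R t st = {}")
    case False
    then obtain k where "k \<in> waiting_in Sys R t st"
      "st1 = ((fst st)(r := Some k), (snd st)(k := slow_speed Sys S R r k t))"
      using st1(1) unfolding rule2_def Let_def rule2_selects_def by auto
    then show ?thesis by (cases "k = j") (simp_all add: waiting_in_def)
  qed (use st1(1) in \<open>simp add: rule2_def\<close>)
  with Cons.IH[OF st1(2)] show ?case by auto
qed simp

section \<open>A single job in both schedules\<close>

text \<open>The invariant of a job mentions no other job, so a single one is fixed. Deadlines enter
  only in \<open>theorem1\<close>.\<close>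

locale mora_job =
  fixes Sys :: system and S :: "'p::linorder scheduler" and R :: run and j :: job and a :: real
  assumes valid: "valid_system Sys"
    and scheduler: "fjp_scheduler Sys S"
    and sporadic: "sporadic Sys (arrival R)"
    and demand_le: "demand R j \<le> wcet Sys (fst j)"
    and mora: "mora_run Sys S R"
    and arr: "arrival R j = Some a"
begin

abbreviation "Off \<equiv> offline_run Sys S (arrival R)"
abbreviation "c \<equiv> wcet Sys (fst j)"
abbreviation "soff \<equiv> off_speed Sys j"
abbreviation "x \<equiv> executed Sys R j"
abbreviation "y \<equiv> executed Sys Off j"

lemma legal: "legal_run Sys R" "legal_run Sys Off"
  using mora scheduler sporadic by (auto simp: mora_run_def fjp_scheduler_def)

lemma migrates: "migrates_only_on_resumption Sys Off"
  using scheduler sporadic by (auto simp: fjp_scheduler_def)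

lemma Off_simps [simp]:
  "arrival Off = arrival R" "speed Off k u = off_speed Sys k" "demand Off j = c"
  by (simp_all add: offline_run_def)

lemma job_in_system: "fst j \<in> {1..num_tasks Sys}" "1 \<le> snd j"
  using sporadic arr by (auto simp: sporadic_def dom_def)

lemma a_nonneg: "0 \<le> a"
  using sporadic arr by (cases j) (auto simp: sporadic_def)

lemma soff_speed: "soff \<in> speeds Sys"
  using valid job_in_system unfolding valid_system_def by (metis prod.collapse)

lemma soff_bounds: "0 < soff" "soff \<le> 1"
  using valid_speeds(3,4)[OF valid soff_speed] by auto

lemma status:
  assumes "a \<le> t"
  shows "completed Sys R j t \<longleftrightarrow> demand R j \<le> x t" "active Sys R j t \<longleftrightarrow> x t < demand R j"
    "completed Sys Off j t \<longleftrightarrow> c \<le> y t" "active Sys Off j t \<longleftrightarrow> y t < c"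
  using assms arr by (auto simp: completed_def active_def arrived_def)

lemma placed:
  assumes "place R' p t = Some j" "p \<in> procs Sys" "legal_run Sys R'" "arrival R' = arrival R"
  shows "a \<le> t" "active Sys R' j t"
proof -
  show "active Sys R' j t" using legal_active assms(1-3) by blast
  then show "a \<le> t" using assms(4) arr by (auto simp: active_def arrived_def)
qed

text \<open>The last inequality says that the worst-case remainder, at the current speed, takes no
  longer than the offline remainder at \<open>soff\<close>. Availability of the speed is
  unconditional: it makes \<open>x\<close> nondecreasing, so that \<open>x t < demand R j\<close>
  passes to earlier times.\<close>

definition keeps_up :: "real \<Rightarrow> bool" where
  "keeps_up t \<longleftrightarrow> speed R j t \<in> speeds Sys \<and>
     (x t < demand R j \<longrightarrow> y t \<le> x t \<and>
       (\<forall>p\<in>procs Sys. place Off p t = Some j \<longrightarrow>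
          place R p t = Some j \<and> (c - x t) * soff \<le> speed R j t * (c - y t)))"

lemma x_mono:
  assumes "a \<le> u" "u \<le> v" "\<And>w. u < w \<Longrightarrow> w < v \<Longrightarrow> keeps_up w"
  shows "x u \<le> x v"
proof (rule executed_mono[OF legal(1)])
  fix w assume "u < w" "w < v"
  then have "speed R j w \<in> speeds Sys" using assms(3) by (simp add: keeps_up_def)
  from valid_speeds(3)[OF valid this] show "0 \<le> speed R j w" by simp
qed (use assms a_nonneg in auto)

lemma keeps_up_at_left:
  assumes "a < t" "\<And>u. a \<le> u \<Longrightarrow> u < t \<Longrightarrow> keeps_up u"
  shows "\<forall>\<^sub>F u in at_left t. keeps_up u \<and> x u \<le> x t"
  using eventually_at_left_real[OF assms(1)]
proof eventually_elim
  case (elim u)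
  with assms(2) x_mono[of u t] show ?case by auto
qed

text \<open>At \<open>a\<close> both amounts are 0. Later, the job is also uncompleted shortly
  before \<open>t\<close>, so the inequality holds there and passes to the limit by
  continuity.\<close>

lemma y_le_x_left:
  assumes "a \<le> t" "\<And>u. a \<le> u \<Longrightarrow> u < t \<Longrightarrow> keeps_up u" "x t < demand R j"
  shows "y t \<le> x t"
proof (cases "t = a")
  case True
  then show ?thesis
    using executed_at_arrival[OF legal(1) arr a_nonneg] executed_at_arrival[OF legal(2) _ a_nonneg] arr
    by simp
next
  case False
  then have t: "a < t" "0 < t" using assms(1) a_nonneg by auto
  have "\<forall>\<^sub>F u in at_left t. keeps_up u \<and> x u \<le> x t"
    using t(1) assms(2) by (rule keeps_up_at_left)
  then have "\<forall>\<^sub>F u in at_left t. y u \<le> x u"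
    by eventually_elim (use assms(3) in \<open>auto simp: keeps_up_def\<close>)
  with executed_tendsto_left[OF legal(1) t(2)] executed_tendsto_left[OF legal(2) t(2)]
  show ?thesis by (intro tendsto_le[OF trivial_limit_at_left_real])
qed

text \<open>From \<open>y t \<le> x t\<close> and \<open>soff \<le> 1\<close> the requested speed is
  at most 1, so rounding up to an available speed is possible; rounding up then gives the
  inequality.\<close>

lemma catch_up_bounds:
  assumes "a \<le> t" "x t < demand R j" "y t \<le> x t"
  shows "catch_up_speed Sys S R j t \<in> speeds Sys"
    "(c - x t) * soff \<le> catch_up_speed Sys S R j t * (c - y t)"
proof -
  define r where "r = (c - x t) * soff / (c - y t)"
  have pos: "0 < c - y t" "0 < c - x t" "c - x t \<le> c - y t" using assms demand_le by auto
  have "(c - x t) * soff \<le> (c - y t) * 1"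
    using pos soff_bounds by (intro mult_mono) auto
  then have "r \<le> 1" using pos by (simp add: r_def)
  have eq: "catch_up_speed Sys S R j t = speed_ceil Sys r"
    using status[OF assms(1)] assms pos by (simp add: catch_up_speed_def remaining_def r_def)
  show "catch_up_speed Sys S R j t \<in> speeds Sys"
    using speed_ceil[OF valid \<open>r \<le> 1\<close>] eq by simp
  have "r \<le> catch_up_speed Sys S R j t" using speed_ceil[OF valid \<open>r \<le> 1\<close>] eq by simp
  then show "(c - x t) * soff \<le> catch_up_speed Sys S R j t * (c - y t)"
    using pos by (simp add: r_def pos_divide_le_eq)
qed

text \<open>Nonnegative slack only enlarges the denominator, so the requested speed is still at most
  1.\<close>

lemma slow_speed_in:
  assumes "a \<le> t" "x t < demand R j" "y t \<le> x t"
  shows "slow_speed Sys S R r j t \<in> speeds Sys"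
proof -
  define L where "L = slack_length Sys S R r j t"
  have pos: "0 < c - y t" "0 < c - x t" "c - x t \<le> c - y t" using assms demand_le by auto
  have L: "0 \<le> L * soff" using slack_length_nonneg[of Sys S R r j t] soff_bounds by (simp add: L_def)
  have "(c - x t) * soff \<le> (c - y t) * 1"
    using pos soff_bounds by (intro mult_mono) auto
  then have "(c - x t) * soff / (c - y t + L * soff) \<le> 1" using pos L by simp
  from speed_ceil(1)[OF valid this] show ?thesis
    using status[OF assms(1)] assms pos by (simp add: slow_speed_def remaining_def L_def)
qed

text \<open>The state at \<open>t\<close> is Rule 1 followed by Rule 2. If the job runs offline,
  Rule 1 already yields the required placement and inequality, and Rule 2 leaves both alone.\<close>

lemma keeps_up_left:
  assumes "a \<le> t" and IH: "\<And>u. a \<le> u \<Longrightarrow> u < t \<Longrightarrow> keeps_up u"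
  shows "keeps_up t"
proof -
  obtain rs st where rs: "set rs = rule2_procs Sys S R t"
    and r2: "rule2_all Sys S R t rs (rule1 Sys S R t) st"
    and pl: "\<And>p. p \<in> procs Sys \<Longrightarrow> place R p t = fst st p"
    and sp: "speed R j t = snd st j"
    using mora unfolding mora_run_def by metis
  have A: "y t \<le> x t" if "x t < demand R j"
    using assms that by (rule y_le_x_left)
  note active = status(2)[OF assms(1)]
  let ?sp = "snd (rule1 Sys S R t) j"
  have near_left: "\<forall>\<^sub>F u in at_left t. keeps_up u \<and> x u \<le> x t" if "a < t"
    using that IH by (rule keeps_up_at_left)
  have arrivals: "after_arrivals Sys R t j \<in> speeds Sys"
  proof (cases "t = a")
    case False
    then have "a < t" using assms(1) by simp
    have "\<forall>\<^sub>F u in at_left t. just_before (speed R j) t \<in> speeds Sys"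
      using near_left[OF \<open>a < t\<close>] step_function_at_left[OF legal_step(2)[OF legal(1)], of j t]
      by eventually_elim (auto simp: keeps_up_def)
    with False arr show ?thesis by (simp add: after_arrivals_def)
  qed (use arr soff_speed in \<open>simp add: after_arrivals_def\<close>)
  then have sp1: "?sp \<in> speeds Sys"
    using catch_up_bounds(1)[OF assms(1)] A active by (auto simp: rule1_def Let_def)
  have "speed R j t \<in> speeds Sys"
    using rule2_all_speed[OF r2, of j] sp1 sp slow_speed_in[OF assms(1)] A active by auto
  moreover have "place R p t = Some j \<and> (c - x t) * soff \<le> speed R j t * (c - y t)"
    if xt: "x t < demand R j" and p: "p \<in> procs Sys" and off: "place Off p t = Some j" for p
  proof -
    have "fst (rule1 Sys S R t) p = Some j \<and> (c - x t) * soff \<le> ?sp * (c - y t)"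
    proof (cases "dispatched Sys Off j p t")
      case True
      then show ?thesis
        using catch_up_bounds(2)[OF assms(1) xt A[OF xt]] active xt p off
        by (auto simp: rule1_def Let_def simp del: split_paired_All split_paired_Ex)
    next
      case False
      \<comment> \<open>Not being dispatched, the job ran offline just before \<open>t\<close>;
        without a preemption it cannot have migrated, so \<open>q\<close> is
        \<open>p\<close>.\<close>
      then obtain q where q: "q \<in> procs Sys" "just_before (place Off q) t = Some j"
        using off by (auto simp: dispatched_def)
      have "place Off q t = Some j"
        using migrates q off p unfolding migrates_only_on_resumption_def running_def by blast
      with off p q(1) legal(2) have "q = p" unfolding legal_run_def by blast
      with q have before: "\<forall>\<^sub>F u in at_left t. place Off p u = Some j"
        using step_function_at_left[OF legal_step(1)[OF legal(2) p], of t] by simp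
      have not_disp: "\<not> dispatched Sys Off j q' t" if "q' \<in> procs Sys" for q'
        using q by (auto simp: dispatched_def)
      \<comment> \<open>A job that ran just before \<open>t\<close> arrived before \<open>t\<close>,
        so left limits of the invariant are available and no arrival resets its speed at
        \<open>t\<close>.\<close>
      have "\<exists>u<t. a \<le> u"
      proof -
        have "\<forall>\<^sub>F u in at_left t. u < t \<and> a \<le> u"
          using before eventually_at_left_real[of "t - 1" t, simplified]
          by eventually_elim (use placed(1)[OF _ p legal(2)] in auto)
        from eventually_happens'[OF trivial_limit_at_left_real this] show ?thesis by auto
      qed
      then have t: "a < t" "0 < t" using a_nonneg by auto
      let ?s = "just_before (speed R j) t"
      have near: "\<forall>\<^sub>F u in at_left t. place R p u = Some j \<and> (c - x u) * soff \<le> ?s * (c - y u)"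
        using near_left[OF t(1)] before step_function_at_left[OF legal_step(2)[OF legal(1)], of j t]
        by eventually_elim (use xt p in \<open>auto simp: keeps_up_def\<close>)
      have jb: "just_before (place R p) t = Some j"
        by (rule just_before_eq) (use near in eventually_elim, simp)
      have lim: "(c - x t) * soff \<le> ?s * (c - y t)"
      proof (rule tendsto_le[OF trivial_limit_at_left_real])
        show "((\<lambda>u. ?s * (c - y u)) \<longlongrightarrow> ?s * (c - y t)) (at_left t)"
          by (intro tendsto_intros executed_tendsto_left legal t)
        show "((\<lambda>u. (c - x u) * soff) \<longlongrightarrow> (c - x t) * soff) (at_left t)"
          by (intro tendsto_intros executed_tendsto_left legal t)
        show "\<forall>\<^sub>F u in at_left t. (c - x u) * soff \<le> ?s * (c - y u)"
          using near by eventually_elim simp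
      qed
      \<comment> \<open>Offline, \<open>p\<close> simply continues with \<open>j\<close>, so Rule 1
        puts no other job on \<open>p\<close>.\<close>
      have "\<not> dispatched Sys Off k p t" for k
        using not_disp[OF p] off by (auto simp: dispatched_def)
      then have "fst (rule1 Sys S R t) p = Some j"
        using not_disp jb active xt by (auto simp: rule1_def Let_def after_completions_def)
      moreover have "?sp = ?s"
        using not_disp arr t by (auto simp: rule1_def Let_def after_arrivals_def)
      ultimately show ?thesis using lim by simp
    qed
    \<comment> \<open>Rule 2 treats only processors that Rule 1 leaves empty.\<close>
    moreover from this have "p \<notin> set rs" by (auto simp: rs rule2_procs_def)
    ultimately show ?thesis using rule2_all_keeps[OF r2 p] pl[OF p] sp by auto
  qed
  ultimately show ?thesis using A by (simp add: keeps_up_def)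
qed

text \<open>Just after \<open>t\<close> all placements and the speed of the job are constant, so
  \<open>x\<close> and \<open>y\<close> are affine there.\<close>

lemma keeps_up_right:
  assumes "a \<le> t" and IH: "keeps_up t"
  shows "\<forall>\<^sub>F u in at_right t. keeps_up u"
proof -
  have "\<forall>\<^sub>F u in at_right t. \<forall>p\<in>procs Sys. place Off p u = place Off p t"
    using step_function_at_right[OF legal_step(1)[OF legal(2)]] by (simp add: eventually_ball_finite)
  moreover have "\<forall>\<^sub>F u in at_right t. \<forall>p\<in>procs Sys. place R p u = place R p t"
    using step_function_at_right[OF legal_step(1)[OF legal(1)]] by (simp add: eventually_ball_finite)
  moreover note step_function_at_right[OF legal_step(2)[OF legal(1)], of j t]
  ultimately have "\<forall>\<^sub>F u in at_right t. (\<forall>p\<in>procs Sys. place Off p u = place Off p t) \<and>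
      (\<forall>p\<in>procs Sys. place R p u = place R p t) \<and> speed R j u = speed R j t"
    by eventually_elim simp
  then obtain b where b: "t < b"
    and offs: "\<And>u p. t < u \<Longrightarrow> u < b \<Longrightarrow> p \<in> procs Sys \<Longrightarrow> place Off p u = place Off p t"
    and acts: "\<And>u p. t < u \<Longrightarrow> u < b \<Longrightarrow> p \<in> procs Sys \<Longrightarrow> place R p u = place R p t"
    and sps: "\<And>u. t < u \<Longrightarrow> u < b \<Longrightarrow> speed R j u = speed R j t"
    by (auto simp: eventually_at_right_field)
  let ?s = "speed R j t"
  have s: "?s \<in> speeds Sys" using IH by (simp add: keeps_up_def)
  have "0 < ?s" by (rule valid_speeds(3)[OF valid s])
  have "keeps_up u" if u: "t < u" "u < b" for u
    unfolding keeps_up_def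
  proof (intro conjI impI)
    show "speed R j u \<in> speeds Sys" using s sps u by simp
    assume xu: "x u < demand R j"
    have t0: "0 \<le> t" using assms(1) a_nonneg by simp
    have xeq: "x u = x t + exec_rate Sys R j t * (u - t)"
      using t0 u acts sps
      by (intro executed_const_rate legal) (auto simp: exec_rate_def running_def)
    have yeq: "y u = y t + exec_rate Sys Off j t * (u - t)"
      using t0 u offs
      by (intro executed_const_rate legal) (auto simp: exec_rate_def running_def)
    have "0 \<le> exec_rate Sys R j t" using \<open>0 < ?s\<close> by (simp add: exec_rate_def)
    then have xt_le: "x t \<le> x u" using xeq u by simp
    then have xt: "x t < demand R j" using xu by simp
    then have yx: "y t \<le> x t"
      and B: "\<And>p. p \<in> procs Sys \<Longrightarrow> place Off p t = Some j \<Longrightarrow>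
        place R p t = Some j \<and> (c - x t) * soff \<le> ?s * (c - y t)"
      using IH by (auto simp: keeps_up_def)
    have run: "place R p u = Some j \<and> (c - x u) * soff \<le> ?s * (c - y u) \<and> y u \<le> x u"
      if p: "p \<in> procs Sys" "place Off p t = Some j" for p
    proof -
      have "place R p u = Some j" using acts[OF u p(1)] B[OF p] by simp
      have "running Sys R j t" "running Sys Off j t" using B[OF p] p by (auto simp: running_def)
      then have xu_eq: "x u = x t + ?s * (u - t)" and yu_eq: "y u = y t + soff * (u - t)"
        using xeq yeq by (simp_all add: exec_rate_def)
      \<comment> \<open>Both sides decrease by the same amount,
        \<open>?s * soff * (u - t)\<close>.\<close>
      have B': "(c - x u) * soff \<le> ?s * (c - y u)"
        using B[OF p] unfolding xu_eq yu_eq by (simp add: algebra_simps)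
      \<comment> \<open>A legal run places only active jobs, and offline the job is still placed at
        \<open>u\<close>.\<close>
      have "y u < c"
        using placed[of Off p u] legal(2) p offs[OF u p(1)] status(4)[of u] assms(1) u by simp
      have "y u \<le> x u"
      \<comment> \<open>At a speed of at least \<open>soff\<close> the lead of \<open>x\<close> over
        \<open>y\<close> cannot shrink; at a lower speed \<open>B'\<close> itself forces
        \<open>c - x u \<le> c - y u\<close>.\<close>
      proof (cases "?s \<ge> soff")
        case True
        then have "soff * (u - t) \<le> ?s * (u - t)" using u by (intro mult_right_mono) auto
        then show ?thesis using yx by (simp add: xu_eq yu_eq)
      next
        case False
        then have "?s * (c - y u) \<le> soff * (c - y u)" using \<open>y u < c\<close> by (intro mult_right_mono) auto
        with B' have "soff * (c - x u) \<le> soff * (c - y u)" by (simp add: mult.commute)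
        then show ?thesis using soff_bounds by simp
      qed
      with \<open>place R p u = Some j\<close> B' show ?thesis by simp
    qed
    show "y u \<le> x u"
    proof (cases "running Sys Off j t")
      case True
      then show ?thesis using run by (auto simp: running_def)
    next
      case False
      then show ?thesis using yeq yx xt_le by (simp add: exec_rate_def)
    qed
    show "\<forall>p\<in>procs Sys. place Off p u = Some j \<longrightarrow>
        place R p u = Some j \<and> (c - x u) * soff \<le> speed R j u * (c - y u)"
      using run offs[OF u] sps[OF u] by simp
  qed
  with b show ?thesis by (auto simp: eventually_at_right_field)
qed

lemma keeps_up: "a \<le> t \<Longrightarrow> keeps_up t"
proof (induction t rule: real_right_induct)
  case (left t)
  then show ?case by (rule keeps_up_left)
next
  case (right t)
  then show ?case using keeps_up_right by simp
qed

text \<open>Otherwise the invariant would give \<open>y t \<le> x t < demand R j \<le> c\<close>,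
  whereas offline completion means \<open>c \<le> y t\<close>.\<close>

lemma completed_if_offline_completed:
  assumes "a \<le> t" "completed Sys Off j t"
  shows "completed Sys R j t"
  using keeps_up[OF assms(1)] assms(2) status[OF assms(1)] demand_le by (force simp: keeps_up_def)

end

theorem theorem1:
  fixes Sys :: system and S :: "'p::linorder scheduler" and R :: run
  assumes "valid_system Sys"
    and "fjp_scheduler Sys S"
    and "schedulable_offline Sys S"
    and "sporadic Sys (arrival R)"
    and "\<And>j. j \<in> dom (arrival R) \<Longrightarrow> 0 \<le> demand R j \<and> demand R j \<le> wcet Sys (fst j)"
    and "mora_run Sys S R"
  shows "deadlines_met Sys R"
  unfolding deadlines_met_def
proof (intro allI impI)
  fix j a
  assume arr: "arrival R j = Some a"
  interpret mora_job Sys S R j a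
    using assms(1,2,4,6) assms(5)[of j] arr by unfold_locales auto
  \<comment> \<open>The comparison of the two schedules is available only from the arrival
    \<open>a\<close> on.\<close>
  have "0 < rel_deadline Sys (fst j)"
    using assms(1) job_in_system(1) by (simp add: valid_system_def)
  moreover have "completed Sys Off j (a + rel_deadline Sys (fst j))"
    using assms(3,4) arr unfolding schedulable_offline_def deadlines_met_def
    by (simp del: split_paired_All)
  ultimately show "completed Sys R j (a + rel_deadline Sys (fst j))"
    by (intro completed_if_offline_completed) simp_all
qed

end
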